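(* The metric space $(\mathcal{K}_D, d_H)$ is compact and totally disconnected. In particular, it is of first category (as a subset of the space $\mathcal{M}$ of all non-empty compact subsets of the circle $[0,1)$ with the Hausdorff metric).
   Context: $[0,1)$ denotes the circle, i.e. the unit interval with $0$ and $1$ identified, with the metric $d_{[0,1)}(t,s)=\min\{|t-s|,1-|t-s|\}$, which makes it a compact metric space. $D:[0,1)\to[0,1)$, $D(x)=2x \pmod 1$, is the doubling map. $\mathcal{K}_D$ is the set of all non-empty compact subsets $K$ of the circle that are invariant under $D$, i.e. $D(K)\subseteq K$. $d_H$ is the Hausdorff metric on non-empty compact subsets of the circle induced by $d_{[0,1)}$. $\mathcal{M}$ is the space of all non-empty compact subsets of the circle with the metric $d_H$. *)

theory Defs
  imports "HOL-Analysis.Analysis"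
begin

section \<open>The circle and the doubling map\<close>

typedef circle = "{0..<1::real}"
  by (rule exI[of _ 0]) simp

instantiation circle :: metric_space
begin

definition dist_circle :: "circle \<Rightarrow> circle \<Rightarrow> real" where
  "dist_circle t s =
     min \<bar>Rep_circle t - Rep_circle s\<bar> (1 - \<bar>Rep_circle t - Rep_circle s\<bar>)"

definition uniformity_circle :: "(circle \<times> circle) filter" where
  "uniformity_circle = (INF e\<in>{0<..}. principal {(x, y). dist x y < e})"

definition open_circle :: "circle set \<Rightarrow> bool" where
  "open_circle U = (\<forall>x\<in>U. \<forall>\<^sub>F (x', y) in uniformity. x' = x \<longrightarrow> y \<in> U)"

instance
proof
  fix x y z :: circle
  have R: "0 \<le> Rep_circle u" "Rep_circle u < 1" for u
    using Rep_circle[of u] by auto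
  show "dist x y = 0 \<longleftrightarrow> x = y"
    using R[of x] R[of y] Rep_circle_inject[of x y] unfolding dist_circle_def by linarith
  show "dist x y \<le> dist x z + dist y z"
    using R[of x] R[of y] R[of z] unfolding dist_circle_def by linarith
qed (simp_all add: uniformity_circle_def open_circle_def)

end

definition doubling :: "circle \<Rightarrow> circle" where
  "doubling x = Abs_circle (frac (2 * Rep_circle x))"

lemma Rep_doubling: "Rep_circle (doubling x) = frac (2 * Rep_circle x)"
  unfolding doubling_def by (rule Abs_circle_inverse) (simp add: frac_lt_1)


section \<open>The Hausdorff metric\<close>

definition nonempty_compacts :: "'a::metric_space set set" where
  "nonempty_compacts = {K. compact K \<and> K \<noteq> {}}"

text \<open>
  The value \<open>0\<close> off the non-empty compact sets is a dummy: the locale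
  \<^locale>\<open>Metric_space\<close> asks for symmetry and nonnegativity on the whole type.
\<close>

definition hausdorff_dist :: "'a::metric_space set \<Rightarrow> 'a set \<Rightarrow> real" where
  "hausdorff_dist K L =
     (if K \<in> nonempty_compacts \<and> L \<in> nonempty_compacts
      then max (SUP x\<in>K. infdist x L) (SUP y\<in>L. infdist y K) else 0)"

lemma bdd_above_infdist:
  assumes "compact (K :: 'a::metric_space set)"
  shows "bdd_above ((\<lambda>x. infdist x L) ` K)"
  by (intro bounded_imp_bdd_above compact_imp_bounded compact_continuous_image assms
      continuous_on_infdist continuous_on_id)

lemma hausdorff_dist_le_iff:
  assumes "K \<in> nonempty_compacts" "L \<in> nonempty_compacts"
  shows "hausdorff_dist K L \<le> r \<longleftrightarrow>
           (\<forall>x\<in>K. infdist x L \<le> r) \<and> (\<forall>y\<in>L. infdist y K \<le> r)"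
  using assms bdd_above_infdist[of K L] bdd_above_infdist[of L K]
  by (simp add: hausdorff_dist_def nonempty_compacts_def cSUP_le_iff)

lemma Metric_space_hausdorff:
  "Metric_space (nonempty_compacts :: 'a::metric_space set set) hausdorff_dist"
proof
  fix K L N :: "'a set"
  show "hausdorff_dist K L = hausdorff_dist L K"
    by (auto simp: hausdorff_dist_def max.commute)
  show nonneg: "0 \<le> hausdorff_dist K L" for K L :: "'a set"
  proof (cases "K \<in> nonempty_compacts \<and> L \<in> nonempty_compacts")
    case True
    then obtain x where "x \<in> K"
      by (auto simp: nonempty_compacts_def)
    then have "infdist x L \<le> hausdorff_dist K L"
      using hausdorff_dist_le_iff[of K L "hausdorff_dist K L"] True by auto
    then show ?thesis
      using infdist_nonneg[of x L] by linarith
  qed (auto simp: hausdorff_dist_def)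
  assume K: "K \<in> nonempty_compacts" and L: "L \<in> nonempty_compacts"
  have in_iff: "x \<in> A \<longleftrightarrow> infdist x A \<le> 0" if "A \<in> nonempty_compacts" for x and A :: "'a set"
    using that in_closed_iff_infdist_zero[of A x] infdist_nonneg[of x A]
    by (auto simp: nonempty_compacts_def compact_imp_closed)
  have "hausdorff_dist K L = 0 \<longleftrightarrow> hausdorff_dist K L \<le> 0"
    using nonneg[of K L] by linarith
  also have "\<dots> \<longleftrightarrow> K = L"
    unfolding hausdorff_dist_le_iff[OF K L] using in_iff[OF K] in_iff[OF L] by blast
  finally show "hausdorff_dist K L = 0 \<longleftrightarrow> K = L" .
  assume N: "N \<in> nonempty_compacts"
  have *: "infdist x C \<le> hausdorff_dist A B + hausdorff_dist B C"
    if A: "A \<in> nonempty_compacts" and B: "B \<in> nonempty_compacts"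
      and C: "C \<in> nonempty_compacts" and x: "x \<in> A" for x and A B C :: "'a set"
  proof -
    have "B \<noteq> {}" "compact B"
      using B by (auto simp: nonempty_compacts_def)
    then obtain y where "y \<in> B" and min: "\<forall>z\<in>B. dist x y \<le> dist x z"
      using continuous_attains_inf[of B "dist x"]
        continuous_on_dist[OF continuous_on_const[of B x] continuous_on_id] by blast
    then have y: "y \<in> B" "infdist x B = dist x y"
      by (auto simp: infdist_notempty[OF \<open>B \<noteq> {}\<close>] intro!: cInf_eq_minimum)
    have "infdist x C \<le> infdist y C + dist x y"
      by (rule infdist_triangle)
    moreover have "infdist y C \<le> hausdorff_dist B C"
      using hausdorff_dist_le_iff[OF B C, of "hausdorff_dist B C"] y by auto
    moreover have "infdist x B \<le> hausdorff_dist A B"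
      using hausdorff_dist_le_iff[OF A B, of "hausdorff_dist A B"] x by auto
    ultimately show ?thesis
      using y by linarith
  qed
  have comm: "hausdorff_dist A B = hausdorff_dist B A" for A B :: "'a set"
    by (auto simp: hausdorff_dist_def max.commute)
  show "hausdorff_dist K N \<le> hausdorff_dist K L + hausdorff_dist L N"
    unfolding hausdorff_dist_le_iff[OF K N]
    using *[OF K L N] *[OF N L K] comm[of N L] comm[of L K] by (simp add: add.commute)
qed

definition hausdorff_metric :: "'a::metric_space set metric" where
  "hausdorff_metric = metric (nonempty_compacts, hausdorff_dist)"

lemma mspace_hausdorff_metric [simp]: "mspace hausdorff_metric = nonempty_compacts"
  unfolding hausdorff_metric_def by (rule Metric_space.mspace_metric[OF Metric_space_hausdorff])

lemma mdist_hausdorff_metric [simp]: "mdist hausdorff_metric = hausdorff_dist"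
  unfolding hausdorff_metric_def by (rule Metric_space.mdist_metric[OF Metric_space_hausdorff])

definition invariant_compacts :: "('a::metric_space \<Rightarrow> 'a) \<Rightarrow> 'a set set" where
  "invariant_compacts f = {K \<in> nonempty_compacts. f ` K \<subseteq> K}"


section \<open>Topological notions\<close>

definition totally_disconnected_space :: "'a topology \<Rightarrow> bool" where
  "totally_disconnected_space X \<longleftrightarrow> (\<forall>S. connectedin X S \<longrightarrow> (\<exists>a. S \<subseteq> {a}))"

definition nowhere_dense_in :: "'a topology \<Rightarrow> 'a set \<Rightarrow> bool" where
  "nowhere_dense_in X S \<longleftrightarrow> S \<subseteq> topspace X \<and> X interior_of (X closure_of S) = {}"

definition first_category_in :: "'a topology \<Rightarrow> 'a set \<Rightarrow> bool" where
  "first_category_in X S \<longleftrightarrow>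
     (\<exists>\<N>. countable \<N> \<and> (\<forall>N\<in>\<N>. nowhere_dense_in X N) \<and> S = \<Union>\<N>)"

end

theory Submission
  imports Defs
begin

text \<open>
  The Hausdorff metric is used through two kinds of open sets: the sets of all \<open>K\<close> that meet a
  given open set, and the sets of all \<open>K\<close> contained in a given open set. These generate the
  Vietoris topology, and the Alexander subbase theorem makes the hyperspace of a compact space
  compact (\<open>compact_space_hausdorff\<close>). If \<open>K\<close> is not invariant, some \<open>x \<in> K\<close> has
  \<open>f x \<notin> K\<close>, and this survives small changes of \<open>K\<close>; hence the invariant sets form a closed,
  and so compact, subspace.

  Total disconnectedness comes from the density of the iterated preimages of a point. Let \<open>K\<close>
  and \<open>L\<close> be distinct invariant sets, say \<open>x \<in> K\<close> and \<open>x \<notin> L\<close>. The points mapped to \<open>x\<close> by the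
  \<open>n\<close>-th iterate of the doubling map form a grid of mesh \<open>1/2^n\<close>, so \<open>x\<close> is interior to a closed
  arc \<open>C\<close> that misses \<open>L\<close> and whose two end points are mapped to \<open>x\<close> by an iterate. An
  invariant set that contains an end point of \<open>C\<close> then contains \<open>x\<close>. Therefore an invariant set
  meets \<open>C\<close> if and only if it meets the interior of \<open>C\<close>: the first condition is closed, the second
  is open, and this clopen condition separates \<open>K\<close> from \<open>L\<close>
  (\<open>totally_disconnected_invariant_compacts\<close>, \<open>doubling_neighbourhood\<close>).

  Finally, every compact set can be approximated by a finite set together with one extra point
  whose image lies outside of the resulting set. So the closed set of invariant sets has empty
  interior, which makes it nowhere dense (\<open>first_category_invariant_compacts\<close>,
  \<open>doubling_escape\<close>).
\<close>

section \<open>Hit sets and inside sets in the Hausdorff metric\<close>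

definition hit_sets :: "'a::metric_space set \<Rightarrow> 'a set set" where
  "hit_sets U = {K \<in> nonempty_compacts. K \<inter> U \<noteq> {}}"

definition inside_sets :: "'a::metric_space set \<Rightarrow> 'a set set" where
  "inside_sets V = {K \<in> nonempty_compacts. K \<subseteq> V}"

lemma hausdorff_dist_lessD:
  assumes K: "K \<in> nonempty_compacts" and L: "L \<in> nonempty_compacts"
    and r: "hausdorff_dist K L < r"
  shows "x \<in> K \<Longrightarrow> \<exists>y\<in>L. dist x y < r" "y \<in> L \<Longrightarrow> \<exists>x\<in>K. dist x y < r"
proof -
  have *: "(\<forall>x\<in>K. infdist x L \<le> hausdorff_dist K L) \<and> (\<forall>y\<in>L. infdist y K \<le> hausdorff_dist K L)"
    using hausdorff_dist_le_iff[OF K L, of "hausdorff_dist K L"] by simp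
  have near: "\<exists>b\<in>B. dist a b < r" if "infdist a B < r" "B \<noteq> {}" for a and B :: "'a set"
    using that by (simp add: infdist_notempty cInf_less_iff bdd_below_image_dist)
  have ne: "K \<noteq> {}" "L \<noteq> {}"
    using K L by (auto simp: nonempty_compacts_def)
  show "x \<in> K \<Longrightarrow> \<exists>y\<in>L. dist x y < r"
    using * near[of x L] r ne by force
  show "y \<in> L \<Longrightarrow> \<exists>x\<in>K. dist x y < r"
    using * near[of y K] r ne by (force simp: dist_commute)
qed

lemma hausdorff_dist_leI:
  assumes K: "K \<in> nonempty_compacts" and L: "L \<in> nonempty_compacts"
    and "\<And>x. x \<in> K \<Longrightarrow> \<exists>y\<in>L. dist x y \<le> r" "\<And>y. y \<in> L \<Longrightarrow> \<exists>x\<in>K. dist x y \<le> r"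
  shows "hausdorff_dist K L \<le> r"
  unfolding hausdorff_dist_le_iff[OF K L]
  using assms(3,4) by (metis dist_commute infdist_le2)

lemma openin_hausdorff_iff:
  "openin (mtopology_of hausdorff_metric) W \<longleftrightarrow>
     W \<subseteq> nonempty_compacts \<and>
     (\<forall>K\<in>W. \<exists>r>0. \<forall>L\<in>nonempty_compacts. hausdorff_dist K L < r \<longrightarrow> L \<in> W)"
  unfolding mtopology_of_def mspace_hausdorff_metric mdist_hausdorff_metric
    Metric_space.openin_mtopology[OF Metric_space_hausdorff]
    Metric_space.mball_def[OF Metric_space_hausdorff] Ball_def[of W]
  by (intro conj_cong refl all_cong imp_cong ex_cong) auto

lemma openin_hit_sets:
  assumes "open U"
  shows "openin (mtopology_of hausdorff_metric) (hit_sets U)"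
  unfolding openin_hausdorff_iff
proof (intro conjI ballI)
  show "hit_sets U \<subseteq> nonempty_compacts"
    by (auto simp: hit_sets_def)
  fix K assume "K \<in> hit_sets U"
  then obtain x where K: "K \<in> nonempty_compacts" and x: "x \<in> K" "x \<in> U"
    by (auto simp: hit_sets_def)
  obtain r where "r > 0" and r: "\<And>y. dist y x < r \<Longrightarrow> y \<in> U"
    using assms x by (auto simp: open_dist)
  have "L \<in> hit_sets U" if L: "L \<in> nonempty_compacts" "hausdorff_dist K L < r" for L
  proof -
    obtain y where "y \<in> L" "dist x y < r"
      using hausdorff_dist_lessD(1)[OF K L x(1)] by blast
    then show ?thesis
      using L r[of y] by (auto simp: hit_sets_def dist_commute)
  qed
  then show "\<exists>r>0. \<forall>L\<in>nonempty_compacts. hausdorff_dist K L < r \<longrightarrow> L \<in> hit_sets U"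
    using \<open>r > 0\<close> by blast
qed

lemma openin_inside_sets:
  assumes "open V"
  shows "openin (mtopology_of hausdorff_metric) (inside_sets V)"
  unfolding openin_hausdorff_iff
proof (intro conjI ballI)
  show "inside_sets V \<subseteq> nonempty_compacts"
    by (auto simp: inside_sets_def)
  fix K assume "K \<in> inside_sets V"
  then have K: "K \<in> nonempty_compacts" and KV: "K \<subseteq> V"
    by (auto simp: inside_sets_def)
  have "compact K"
    using K by (simp add: nonempty_compacts_def)
  then obtain r where "r > 0" and r: "\<And>x. x \<in> K \<Longrightarrow> ball x r \<subseteq> V"
    using Heine_Borel_lemma[of K "{V}"] KV assms by (metis cSup_singleton singletonD)
  have "L \<in> inside_sets V" if L: "L \<in> nonempty_compacts" "hausdorff_dist K L < r" for L
    using hausdorff_dist_lessD(2)[OF K L] L r by (fastforce simp: inside_sets_def)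
  then show "\<exists>r>0. \<forall>L\<in>nonempty_compacts. hausdorff_dist K L < r \<longrightarrow> L \<in> inside_sets V"
    using \<open>r > 0\<close> by blast
qed

text \<open>
  Missing a closed set means lying inside its open complement. So the condition of meeting \<open>C\<close> is
  closed for closed \<open>C\<close>, while it is open for open \<open>C\<close>; a set for which both descriptions
  agree gives a clopen condition.
\<close>

lemma closedin_hit_sets:
  assumes "closed C"
  shows "closedin (mtopology_of hausdorff_metric) (hit_sets C)"
proof -
  have "nonempty_compacts - hit_sets C = inside_sets (- C)"
    by (auto simp: hit_sets_def inside_sets_def)
  then show ?thesis
    using openin_inside_sets[of "- C"] assms
    by (auto simp: closedin_def hit_sets_def)
qed

section \<open>Compactness of the hyperspace\<close>

definition vietoris_subbase :: "'a::metric_space set set set" where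
  "vietoris_subbase = hit_sets ` {U. open U} \<union> inside_sets ` {V. open V}"

text \<open>
  The topology is given in the form in which the Alexander subbase theorem expects a subbase.
\<close>

definition vietoris_topology :: "'a::metric_space set topology" where
  "vietoris_topology = topology (arbitrary union_of
     (finite intersection_of (\<lambda>W. W \<in> vietoris_subbase) relative_to nonempty_compacts))"

lemma topspace_vietoris: "topspace vietoris_topology = nonempty_compacts"
  by (simp add: vietoris_topology_def)

lemma openin_vietoris_Inter:
  assumes "finite \<F>" "\<F> \<subseteq> vietoris_subbase"
  shows "openin vietoris_topology (nonempty_compacts \<inter> \<Inter>\<F>)"
  unfolding vietoris_topology_def openin_subbase
  by (rule arbitrary_union_of_inc, rule relative_to_inc)
    (use assms in \<open>auto simp: intersection_of_def\<close>)

text \<open>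
  By the Alexander subbase theorem only covers by subbasic sets need a finite subcover. Let \<open>A\<close> be
  the complement of the union of all open \<open>U\<close> whose hit set belongs to the cover. If \<open>A\<close> is
  nonempty, it is itself a point of the hyperspace; no hit set of the cover contains it, so it lies
  in an inside set, given by some \<open>V \<supseteq> A\<close>. The rest of the space is compact and covered by the
  sets \<open>U\<close>, so finitely many of them suffice. A compact set now either lies inside \<open>V\<close> or meets
  one of these finitely many \<open>U\<close>.
\<close>

lemma compact_space_vietoris:
  assumes "compact (UNIV :: 'a::metric_space set)"
  shows "compact_space (vietoris_topology :: 'a set topology)"
proof (rule Alexander_subbase_alt[OF _ _ vietoris_topology_def[symmetric]])
  show "(nonempty_compacts :: 'a set set) \<subseteq> \<Union>vietoris_subbase"
    by (auto simp: vietoris_subbase_def inside_sets_def)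
next
  fix \<C> :: "'a set set set"
  assume \<C>: "\<C> \<subseteq> vietoris_subbase" and cover: "nonempty_compacts \<subseteq> \<Union>\<C>"
  define \<U> where "\<U> = {U. open U \<and> hit_sets U \<in> \<C>}"
  define A where "A = - \<Union>\<U>"
  have \<U>: "\<And>U. U \<in> \<U> \<Longrightarrow> open U"
    by (simp add: \<U>_def)
  have "closed A"
    unfolding A_def using \<U> by (auto intro!: closed_Compl open_Union)
  have comp: "compact B" if "closed B" for B :: "'a set"
    using compact_Int_closed[OF assms that] by simp
  \<comment> \<open>The value \<open>V = {}\<close> stands for the case that no inside set is required.\<close>
  obtain V where V: "open V" "A \<subseteq> V" "V = {} \<or> inside_sets V \<in> \<C>"
  proof (cases "A = {}")
    case True
    then show ?thesis using that[of "{}"] by simp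
  next
    case False
    then have A: "A \<in> nonempty_compacts"
      using comp[OF \<open>closed A\<close>] by (simp add: nonempty_compacts_def)
    then obtain W where W: "W \<in> \<C>" "A \<in> W"
      using cover by blast
    have "W \<noteq> hit_sets U" if "open U" for U
      using W that by (auto simp: hit_sets_def \<U>_def A_def)
    then obtain V where "open V" "W = inside_sets V"
      using W(1) \<C> unfolding vietoris_subbase_def by blast
    then show ?thesis
      using that[of V] W by (auto simp: inside_sets_def)
  qed
  have "compact (- V)" "- V \<subseteq> \<Union>\<U>"
    using V(1,2) by (auto intro: comp simp: A_def)
  then obtain \<D> where \<D>: "\<D> \<subseteq> \<U>" "finite \<D>" "- V \<subseteq> \<Union>\<D>"
    using \<U> by (metis compactE)
  define \<C>' where "\<C>' = hit_sets ` \<D> \<union> (if V = {} then {} else {inside_sets V})"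
  have "\<C>' \<subseteq> \<C>"
    using V(3) \<D>(1) by (auto simp: \<C>'_def \<U>_def)
  moreover have "K \<in> \<Union>\<C>'" if K: "K \<in> nonempty_compacts" for K
  proof (cases "K \<subseteq> V")
    case True
    then have "V \<noteq> {}" using K by (auto simp: nonempty_compacts_def)
    then show ?thesis
      using True K by (auto simp: \<C>'_def inside_sets_def)
  next
    case False
    then obtain U where "U \<in> \<D>" "K \<inter> U \<noteq> {}"
      using \<D>(3) by blast
    then show ?thesis
      using K by (auto simp: \<C>'_def hit_sets_def)
  qed
  ultimately show "\<exists>\<C>'. finite \<C>' \<and> \<C>' \<subseteq> \<C> \<and> nonempty_compacts \<subseteq> \<Union>\<C>'"
    using \<D>(2) by (intro exI[of _ \<C>'] conjI subsetI) (simp add: \<C>'_def, blast+)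
qed

lemma finite_net:
  assumes K: "K \<in> nonempty_compacts" and "r > 0"
  obtains F where "finite F" "F \<noteq> {}" "F \<subseteq> K" "K \<subseteq> (\<Union>x\<in>F. ball x r)"
proof -
  have "compact K" "K \<noteq> {}"
    using K by (auto simp: nonempty_compacts_def)
  obtain F where F: "F \<subseteq> K" "finite F" "K \<subseteq> (\<Union>x\<in>F. ball x r)"
    using compactE_image[OF \<open>compact K\<close>, of K "\<lambda>x. ball x r"] \<open>r > 0\<close> centre_in_ball
    by (metis UN_I open_ball subsetI)
  moreover have "F \<noteq> {}"
    using F(3) \<open>K \<noteq> {}\<close> by auto
  ultimately show ?thesis
    using that[of F] by simp
qed

text \<open>
  A Hausdorff ball around \<open>K\<close> contains a finite intersection of subbasic sets: take a finite net
  \<open>F \<subseteq> K\<close>, and require of \<open>L\<close> that it lies in the union of the small balls around the net and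
  meets each of them.
\<close>

lemma openin_vietoris_if_openin_hausdorff:
  assumes W: "openin (mtopology_of hausdorff_metric) W"
  shows "openin vietoris_topology W"
proof (subst openin_subopen, intro ballI)
  fix K assume "K \<in> W"
  then obtain r where "r > 0" and K: "K \<in> nonempty_compacts"
    and r: "\<And>L. L \<in> nonempty_compacts \<Longrightarrow> hausdorff_dist K L < r \<Longrightarrow> L \<in> W"
    using W unfolding openin_hausdorff_iff by blast
  \<comment> \<open>A point of \<open>K\<close> reaches \<open>L\<close> in two steps of length below \<open>r/4\<close>, via the net. The total
    \<open>r/2\<close> keeps the supremum in the Hausdorff distance strictly below \<open>r\<close>.\<close>
  obtain F where F: "finite F" "F \<noteq> {}" "F \<subseteq> K" "K \<subseteq> (\<Union>x\<in>F. ball x (r/4))"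
    using finite_net[OF K, of "r/4"] \<open>r > 0\<close> by auto
  define \<F> where "\<F> = insert (inside_sets (\<Union>x\<in>F. ball x (r/4))) ((\<lambda>x. hit_sets (ball x (r/4))) ` F)"
  have sub: "\<F> \<subseteq> vietoris_subbase"
    by (auto simp: \<F>_def vietoris_subbase_def)
  have "openin vietoris_topology (nonempty_compacts \<inter> \<Inter>\<F>)"
    by (rule openin_vietoris_Inter[OF _ sub]) (simp add: \<F>_def F(1))
  moreover have "K \<in> nonempty_compacts \<inter> \<Inter>\<F>"
    using K F \<open>r > 0\<close> by (force simp: \<F>_def hit_sets_def inside_sets_def)
  moreover have "nonempty_compacts \<inter> \<Inter>\<F> \<subseteq> W"
  proof
    fix L assume L: "L \<in> nonempty_compacts \<inter> \<Inter>\<F>"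
    then have Lc: "L \<in> nonempty_compacts" and inside: "L \<subseteq> (\<Union>x\<in>F. ball x (r/4))"
      and hit: "\<And>x. x \<in> F \<Longrightarrow> L \<inter> ball x (r/4) \<noteq> {}"
      by (auto simp: \<F>_def hit_sets_def inside_sets_def)
    have "hausdorff_dist K L \<le> r/2"
    proof (rule hausdorff_dist_leI[OF K Lc])
      fix x assume "x \<in> K"
      then obtain z where z: "z \<in> F" "dist z x < r/4"
        using F(4) by auto
      then obtain y where "y \<in> L" "dist z y < r/4"
        using hit[of z] by auto
      then show "\<exists>y\<in>L. dist x y \<le> r/2"
        using z dist_triangle3[of x y z] by (intro bexI[of _ y]) auto
    next
      fix y assume "y \<in> L"
      then obtain z where "z \<in> F" "dist z y < r/4"
        using inside by auto
      then show "\<exists>x\<in>K. dist x y \<le> r/2"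
        using F(3) \<open>r > 0\<close> by (intro bexI[of _ z]) auto
    qed
    then show "L \<in> W"
      using r[OF Lc] \<open>r > 0\<close> by simp
  qed
  ultimately show "\<exists>T. openin vietoris_topology T \<and> K \<in> T \<and> T \<subseteq> W"
    by blast
qed

text \<open>Compactness passes from a finer topology to a coarser one along the identity map.\<close>

lemma compact_space_hausdorff:
  assumes "compact (UNIV :: 'a::metric_space set)"
  shows "compact_space (mtopology_of (hausdorff_metric :: 'a set metric))"
proof -
  have "continuous_map vietoris_topology (mtopology_of (hausdorff_metric :: 'a set metric)) id"
  proof (unfold continuous_map, intro conjI allI impI)
    show "id ` topspace vietoris_topology \<subseteq> topspace (mtopology_of (hausdorff_metric :: 'a set metric))"
      by (simp add: topspace_vietoris)
    fix W :: "'a set set"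
    assume W: "openin (mtopology_of hausdorff_metric) W"
    have "{K \<in> topspace vietoris_topology. id K \<in> W} = W"
      using openin_subset[OF W] by (auto simp: topspace_vietoris)
    then show "openin vietoris_topology {K \<in> topspace vietoris_topology. id K \<in> W}"
      using openin_vietoris_if_openin_hausdorff[OF W] by simp
  qed
  then have "compactin (mtopology_of hausdorff_metric) (id ` (nonempty_compacts :: 'a set set))"
    by (rule image_compactin[rotated])
      (use compact_space_vietoris[OF assms] in \<open>simp add: compact_space_def topspace_vietoris\<close>)
  then show ?thesis
    by (simp add: compact_space_def)
qed

section \<open>Invariant compact sets\<close>

text \<open>
  If \<open>x \<in> K\<close> and \<open>f x \<notin> K\<close>, then every \<open>L\<close> that has a point near \<open>x\<close> and stays away from a
  neighbourhood of \<open>f x\<close> fails to be invariant for the same reason.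
\<close>

lemma closedin_invariant_compacts:
  fixes f :: "'a::metric_space \<Rightarrow> 'a"
  assumes f: "continuous_on UNIV f"
  shows "closedin (mtopology_of hausdorff_metric) (invariant_compacts f)"
proof -
  have "openin (mtopology_of hausdorff_metric) (nonempty_compacts - invariant_compacts f)"
  proof (subst openin_subopen, intro ballI)
    fix K assume "K \<in> nonempty_compacts - invariant_compacts f"
    then obtain x where K: "K \<in> nonempty_compacts" and x: "x \<in> K" "f x \<notin> K"
      by (auto simp: invariant_compacts_def)
    have "closed K"
      using K by (auto simp: nonempty_compacts_def compact_imp_closed)
    then obtain r where "r > 0" and r: "ball (f x) r \<subseteq> - K"
      using x(2) by (metis open_Compl open_contains_ball ComplI)
    define U where "U = f -` ball (f x) (r/2)"
    define V where "V = - cball (f x) (r/2)"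
    define T where "T = hit_sets U \<inter> inside_sets V"
    have "open U"
      unfolding U_def using f by (intro open_vimage) auto
    then have "openin (mtopology_of hausdorff_metric) T"
      unfolding T_def V_def by (intro openin_Int openin_hit_sets openin_inside_sets) auto
    moreover have "cball (f x) (r/2) \<subseteq> ball (f x) r"
      using \<open>r > 0\<close> by auto
    then have "K \<in> T"
      using K x r \<open>r > 0\<close> by (auto simp: T_def U_def V_def hit_sets_def inside_sets_def)
    moreover have "T \<subseteq> nonempty_compacts - invariant_compacts f"
      by (fastforce simp: T_def U_def V_def hit_sets_def inside_sets_def invariant_compacts_def)
    ultimately show "\<exists>T. openin (mtopology_of hausdorff_metric) T \<and> K \<in> T \<and>
        T \<subseteq> nonempty_compacts - invariant_compacts f"
      by blast
  qed
  then show ?thesis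
    by (auto simp: closedin_def invariant_compacts_def)
qed

lemma funpow_mem_invariant:
  assumes "f ` K \<subseteq> K" "x \<in> K"
  shows "(f ^^ n) x \<in> K"
  using assms by (induction n) auto

text \<open>
  The hypothesis provides arbitrarily small closed neighbourhoods \<open>C\<close> of \<open>x\<close> all of whose
  boundary points eventually return to \<open>x\<close>. For invariant sets, touching the boundary of \<open>C\<close>
  forces them to contain \<open>x\<close> and hence to meet the interior. So meeting \<open>C\<close> is a clopen condition.
\<close>

lemma totally_disconnected_invariant_compacts:
  fixes f :: "'a::metric_space \<Rightarrow> 'a"
  assumes nbhd: "\<And>x r. r > 0 \<Longrightarrow> \<exists>C. closed C \<and> C \<subseteq> ball x r \<and> x \<in> interior C \<and>
                   (\<forall>y\<in>C - interior C. \<exists>n. (f ^^ n) y = x)"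
  shows "totally_disconnected_space
           (subtopology (mtopology_of hausdorff_metric) (invariant_compacts f))"
    (is "totally_disconnected_space ?X")
proof -
  have sep: False
    if S: "connectedin ?X S" and KL: "K \<in> S" "L \<in> S" and x: "x \<in> K" "x \<notin> L" for S K L x
  proof -
    have inv: "S \<subseteq> invariant_compacts f"
      using S by (simp add: connectedin_subtopology)
    have L: "closed L" 
      using KL inv by (auto simp: invariant_compacts_def nonempty_compacts_def compact_imp_closed)
    obtain r where "r > 0" "ball x r \<subseteq> - L"
      using x(2) L by (metis open_Compl open_contains_ball ComplI)
    then obtain C where C: "closed C" "C \<inter> L = {}" "x \<in> interior C"
      and to_x: "\<And>y. y \<in> C - interior C \<Longrightarrow> \<exists>n. (f ^^ n) y = x"
      using nbhd[of r x] by blast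
    have same: "invariant_compacts f \<inter> hit_sets C = invariant_compacts f \<inter> hit_sets (interior C)"
    proof -
      have "N \<inter> interior C \<noteq> {}"
        if N: "N \<in> invariant_compacts f" and y: "y \<in> N" "y \<in> C" for N y
      proof (cases "y \<in> interior C")
        case False
        then obtain n where "(f ^^ n) y = x"
          using to_x y by blast
        then have "x \<in> N"
          using funpow_mem_invariant[of f N y n] N y by (auto simp: invariant_compacts_def)
        then show ?thesis
          using C(3) by blast
      qed (use y in blast)
      then show ?thesis
        using interior_subset[of C] by (fastforce simp: hit_sets_def)
    qed
    have "closedin ?X (invariant_compacts f \<inter> hit_sets C)"
      using closedin_hit_sets[OF C(1)] by (auto simp: closedin_subtopology)
    moreover have "openin ?X (invariant_compacts f \<inter> hit_sets C)"
      unfolding same using openin_hit_sets[of "interior C"] by (auto simp: openin_subtopology)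
    ultimately have "S \<subseteq> hit_sets C \<or> disjnt S (invariant_compacts f \<inter> hit_sets C)"
      using connectedin_clopen_cases[OF S] by blast
    moreover have "K \<in> invariant_compacts f \<inter> hit_sets C"
      using KL(1) inv C(3) interior_subset[of C] x(1)
      by (auto simp: hit_sets_def invariant_compacts_def)
    moreover have "L \<notin> hit_sets C"
      using C(2) by (auto simp: hit_sets_def)
    ultimately show False
      using KL by (auto simp: disjnt_def)
  qed
  show ?thesis
    unfolding totally_disconnected_space_def
  proof (intro allI impI)
    fix S assume S: "connectedin ?X S"
    have "K = L" if "K \<in> S" "L \<in> S" for K L
      using sep[OF S that] sep[OF S that(2,1)] by blast
    then show "\<exists>a. S \<subseteq> {a}"
      by (cases "S = {}") blast+
  qed
qed

text \<open>
  The set of invariant sets is closed, so it is enough that it has empty interior. Given \<open>K\<close>, a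
  finite net \<open>F \<subseteq> K\<close> together with a point \<open>z\<close> close to \<open>F\<close> approximates \<open>K\<close>, and the second
  hypothesis allows \<open>z\<close> to be chosen with \<open>f z\<close> outside of \<open>insert z F\<close>.
\<close>

lemma first_category_invariant_compacts:
  fixes f :: "'a::metric_space \<Rightarrow> 'a"
  assumes f: "continuous_on UNIV f"
    and escape: "\<And>x r F. r > 0 \<Longrightarrow> finite F \<Longrightarrow> \<exists>z. dist x z < r \<and> f z \<notin> insert z F"
  shows "first_category_in (mtopology_of hausdorff_metric) (invariant_compacts f)"
proof -
  let ?H = "mtopology_of (hausdorff_metric :: 'a set metric)"
  have no_open: "K \<notin> W" if W: "openin ?H W" "W \<subseteq> invariant_compacts f" for W K
  proof
    assume "K \<in> W"
    then obtain r where "r > 0" and K: "K \<in> nonempty_compacts"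
      and r: "\<And>L. L \<in> nonempty_compacts \<Longrightarrow> hausdorff_dist K L < r \<Longrightarrow> L \<in> W"
      using W(1) unfolding openin_hausdorff_iff by blast
    obtain F where F: "finite F" "F \<noteq> {}" "F \<subseteq> K" "K \<subseteq> (\<Union>x\<in>F. ball x (r/2))"
      using finite_net[OF K, of "r/2"] \<open>r > 0\<close> by auto
    then obtain x where x: "x \<in> F"
      by blast
    then obtain z where z: "dist x z < r/2" "f z \<notin> insert z F"
      using escape[of "r/2" F x] \<open>r > 0\<close> F(1) by auto
    have zF: "insert z F \<in> nonempty_compacts"
      using F(1) by (simp add: nonempty_compacts_def finite_imp_compact)
    have "hausdorff_dist K (insert z F) \<le> r/2"
    proof (rule hausdorff_dist_leI[OF K zF])
      fix y assume "y \<in> K"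
      then obtain w where "w \<in> F" "dist w y < r/2"
        using F(4) by auto
      then show "\<exists>w\<in>insert z F. dist y w \<le> r/2"
        by (intro bexI[of _ w]) (auto simp: dist_commute)
    next
      fix y assume "y \<in> insert z F"
      then show "\<exists>w\<in>K. dist w y \<le> r/2"
      proof
        assume "y = z"
        then show ?thesis using x z(1) F(3) by (intro bexI[of _ x]) auto
      next
        assume "y \<in> F"
        then show ?thesis using F(3) \<open>r > 0\<close> by (intro bexI[of _ y]) auto
      qed
    qed
    then have "insert z F \<in> invariant_compacts f"
      using r[OF zF] W(2) \<open>r > 0\<close> by auto
    then show False
      using z(2) by (auto simp: invariant_compacts_def)
  qed
  have "?H interior_of invariant_compacts f = {}"
    using no_open[OF openin_interior_of interior_of_subset] by blast
  then have "nowhere_dense_in ?H (invariant_compacts f)"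
    using closedin_invariant_compacts[OF f] closedin_subset[OF closedin_invariant_compacts[OF f]]
    by (simp add: nowhere_dense_in_def closure_of_closedin)
  then show ?thesis
    unfolding first_category_in_def by (intro exI[of _ "{invariant_compacts f}"]) simp
qed

section \<open>The doubling map\<close>

text \<open>
  The quotient map from the line. Through it the circle metric becomes the distance on the line up
  to integer shifts, and doubling becomes multiplication by 2, without case distinctions for
  points near 0.
\<close>

definition circle_of :: "real \<Rightarrow> circle" where
  "circle_of t = Abs_circle (frac t)"

lemma Rep_circle_of: "Rep_circle (circle_of t) = frac t"
  unfolding circle_of_def by (rule Abs_circle_inverse) (simp add: frac_lt_1)

lemma Rep_circle_bounds: "0 \<le> Rep_circle x" "Rep_circle x < 1"
  using Rep_circle[of x] by auto

lemma circle_of_Rep: "circle_of (Rep_circle x) = x"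
  by (metis Rep_circle_of Rep_circle_bounds frac_eq Rep_circle_inject)

lemma circle_of_add_int: "circle_of (t + of_int k) = circle_of t"
  by (simp add: circle_of_def frac_def)

lemma dist_circle_of_le: "dist (circle_of s) (circle_of t) \<le> \<bar>s - t\<bar>"
proof -
  have b: "0 \<le> frac s" "frac s < 1" "0 \<le> frac t" "frac t < 1"
    by (auto simp: frac_lt_1)
  have eq: "s - t = frac s - frac t + of_int (\<lfloor>s\<rfloor> - \<lfloor>t\<rfloor>)"
    by (simp add: frac_def)
  consider "\<lfloor>s\<rfloor> - \<lfloor>t\<rfloor> = 0" | "\<lfloor>s\<rfloor> - \<lfloor>t\<rfloor> \<ge> 1" | "\<lfloor>s\<rfloor> - \<lfloor>t\<rfloor> \<le> - 1"
    by linarith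
  then show ?thesis
  proof cases
    case 1
    then show ?thesis using eq by (simp add: dist_circle_def Rep_circle_of)
  next
    case 2
    then have "real_of_int (\<lfloor>s\<rfloor> - \<lfloor>t\<rfloor>) \<ge> 1" by linarith
    then show ?thesis using eq b unfolding dist_circle_def Rep_circle_of by linarith
  next
    case 3
    then have "real_of_int (\<lfloor>s\<rfloor> - \<lfloor>t\<rfloor>) \<le> - 1" by linarith
    then show ?thesis using eq b unfolding dist_circle_def Rep_circle_of by linarith
  qed
qed

text \<open>
  Each point \<open>y\<close> has a lift at its exact circle distance from a given lift \<open>s\<close>. This turns metric
  statements on the circle into statements on the line: openness of \<open>circle_of\<close> and the Lipschitz
  bound for doubling both rest on it.
\<close>

lemma circle_of_lift:
  obtains t where "circle_of t = y" "\<bar>s - t\<bar> = dist (circle_of s) y"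
proof -
  \<comment> \<open>The lift of \<open>y\<close> in the same unit interval as \<open>s\<close>; one of its neighbouring translates may be
    closer.\<close>
  let ?u = "Rep_circle y + of_int \<lfloor>s\<rfloor>"
  have lifts: "circle_of (?u + of_int k) = y" for k
    by (metis circle_of_Rep circle_of_add_int)
  have d: "dist (circle_of s) y = min \<bar>s - ?u\<bar> (1 - \<bar>s - ?u\<bar>)"
    by (simp add: dist_circle_def Rep_circle_of frac_def algebra_simps)
  have "\<bar>s - ?u\<bar> < 1"
    using Rep_circle_bounds[of y] frac_ge_0[of s] frac_lt_1[of s] unfolding frac_def by linarith
  then consider "dist (circle_of s) y = \<bar>s - ?u\<bar>"
    | "dist (circle_of s) y = \<bar>s - (?u + 1)\<bar>" | "dist (circle_of s) y = \<bar>s - (?u - 1)\<bar>"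
    unfolding d by linarith
  then show ?thesis
    using that[of ?u] that[of "?u + 1"] that[of "?u - 1"] lifts[of 0] lifts[of 1] lifts[of "-1"]
    by cases simp_all
qed

lemma continuous_on_circle_of: "continuous_on A circle_of"
  unfolding continuous_on_iff
  by (metis dist_circle_of_le dist_real_def order_le_less_trans)

lemma open_circle_of_image:
  assumes "open A"
  shows "open (circle_of ` A)"
  unfolding open_dist
proof
  fix x assume "x \<in> circle_of ` A"
  then obtain s where s: "s \<in> A" "x = circle_of s"
    by blast
  then obtain r where "r > 0" and r: "\<And>t. dist t s < r \<Longrightarrow> t \<in> A"
    using assms by (auto simp: open_dist)
  have "y \<in> circle_of ` A" if "dist y x < r" for y
  proof -
    obtain t where t: "circle_of t = y" "\<bar>s - t\<bar> = dist (circle_of s) y"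
      by (rule circle_of_lift)
    then have "t \<in> A"
      using that s(2) by (intro r) (simp add: dist_real_def dist_commute abs_minus_commute)
    then show ?thesis
      using t(1) by blast
  qed
  then show "\<exists>r>0. \<forall>y. dist y x < r \<longrightarrow> y \<in> circle_of ` A"
    using \<open>r > 0\<close> by blast
qed

lemma compact_circle: "compact (UNIV :: circle set)"
proof -
  have "x \<in> circle_of ` {0..1}" for x
    using circle_of_Rep[of x, symmetric] Rep_circle_bounds[of x] by (intro image_eqI) auto
  then have "(UNIV :: circle set) = circle_of ` {0..1}"
    by blast
  then show ?thesis
    by (metis compact_continuous_image continuous_on_circle_of compact_Icc)
qed

lemma doubling_circle_of: "doubling (circle_of t) = circle_of (2 * t)"
proof -
  have "circle_of (2 * t) = circle_of (2 * frac t + of_int (2 * \<lfloor>t\<rfloor>))"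
    by (simp add: frac_def algebra_simps)
  also have "\<dots> = circle_of (2 * frac t)"
    by (rule circle_of_add_int)
  finally show ?thesis
    unfolding doubling_def Rep_circle_of by (simp add: circle_of_def)
qed

lemma doubling_funpow_circle_of: "(doubling ^^ n) (circle_of t) = circle_of (2 ^ n * t)"
  by (induction n) (simp_all add: doubling_circle_of mult.assoc)

lemma continuous_on_doubling: "continuous_on UNIV doubling"
proof -
  have "dist (doubling x) (doubling y) \<le> 2 * dist x y" for x y
  proof -
    obtain t where t: "circle_of t = y" "\<bar>Rep_circle x - t\<bar> = dist x y"
      using circle_of_lift[of y "Rep_circle x"] circle_of_Rep[of x] by metis
    have "dist (doubling x) (doubling y) = dist (circle_of (2 * Rep_circle x)) (circle_of (2 * t))"
      by (metis t(1) circle_of_Rep doubling_circle_of)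
    also have "\<dots> \<le> \<bar>2 * Rep_circle x - 2 * t\<bar>"
      by (rule dist_circle_of_le)
    finally show ?thesis
      using t(2) by linarith
  qed
  then have "2-lipschitz_on UNIV doubling"
    by (intro lipschitz_onI) auto
  then show ?thesis
    by (rule lipschitz_on_continuous_on)
qed

text \<open>
  The points \<open>(t + j) / 2^n\<close>, for integers \<open>j\<close>, are all mapped to the class of \<open>t\<close> by the \<open>n\<close>-th
  iterate. Two of them enclose \<open>t\<close> in an interval of length \<open>2/2^n\<close>, whose image is the arc \<open>C\<close>.
\<close>

lemma doubling_neighbourhood:
  assumes "r > 0"
  shows "\<exists>C. closed C \<and> C \<subseteq> ball x r \<and> x \<in> interior C \<and>
           (\<forall>y\<in>C - interior C. \<exists>n. (doubling ^^ n) y = x)"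
proof -
  define t where "t = Rep_circle x"
  have x: "x = circle_of t"
    by (simp add: t_def circle_of_Rep)
  obtain n where n: "2 / r < 2 ^ n"
    using real_arch_pow[of 2 "2 / r"] by auto
  define k where "k = \<lfloor>2 ^ n * t - t\<rfloor>"
  \<comment> \<open>The grid point with index \<open>k\<close> is the last one not above \<open>t\<close> and may equal \<open>t\<close> (when \<open>x\<close> is
    periodic), so its two neighbours are taken as end points.\<close>
  define a b where "a = (t + of_int (k - 1)) / 2 ^ n" and "b = (t + of_int (k + 1)) / 2 ^ n"
  have ends: "(doubling ^^ n) (circle_of a) = x" "(doubling ^^ n) (circle_of b) = x"
    using circle_of_add_int[of t "k - 1"] circle_of_add_int[of t "k + 1"]
    by (simp_all add: doubling_funpow_circle_of a_def b_def x)
  have k: "of_int k \<le> 2 ^ n * t - t" "2 ^ n * t - t < of_int k + 1"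
    unfolding k_def by linarith+
  have at: "a < t" and tb: "t < b"
    using k by (auto simp: a_def b_def field_simps)
  have "b - a = 2 / 2 ^ n"
    by (simp add: a_def b_def field_simps)
  also have "\<dots> < r"
    using n assms by (simp add: field_simps)
  finally have ab: "b - a < r" .
  define C where "C = circle_of ` {a..b}"
  have inner: "circle_of ` {a<..<b} \<subseteq> interior C"
    unfolding C_def by (intro interior_maximal open_circle_of_image image_mono) auto
  have "closed C"
    unfolding C_def
    by (intro compact_imp_closed compact_continuous_image continuous_on_circle_of compact_Icc)
  moreover have "C \<subseteq> ball x r"
  proof
    fix y assume "y \<in> C"
    then obtain s where s: "a \<le> s" "s \<le> b" "y = circle_of s"
      by (auto simp: C_def)
    then have "dist x y \<le> \<bar>t - s\<bar>"
      unfolding x s(3) by (intro dist_circle_of_le)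
    then show "y \<in> ball x r"
      using s(1,2) at tb ab by simp
  qed
  moreover have "x \<in> interior C"
    using inner at tb x by auto
  moreover have "\<exists>n. (doubling ^^ n) y = x" if y: "y \<in> C - interior C" for y
  proof -
    obtain s where s: "a \<le> s" "s \<le> b" "y = circle_of s"
      using y by (auto simp: C_def)
    have "s \<notin> {a<..<b}"
      using y inner s(3) by blast
    then have "s = a \<or> s = b"
      using s(1,2) by auto
    then show ?thesis
      using ends s(3) by blast
  qed
  ultimately show ?thesis
    by blast
qed

lemma countable_circle_of_double: "countable {s. circle_of (2 * s) = y}"
proof (rule countable_subset)
  show "{s. circle_of (2 * s) = y} \<subseteq> range (\<lambda>k::int. (Rep_circle y + of_int k) / 2)"
  proof
    fix s assume "s \<in> {s. circle_of (2 * s) = y}"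
    then have "Rep_circle y = 2 * s - of_int \<lfloor>2 * s\<rfloor>"
      by (auto simp: Rep_circle_of frac_def)
    then show "s \<in> range (\<lambda>k::int. (Rep_circle y + of_int k) / 2)"
      by (intro range_eqI[of _ _ "\<lfloor>2 * s\<rfloor>"]) simp
  qed
qed simp

text \<open>
  Only countably many lifts \<open>s\<close> are bad: those where doubling lands in \<open>F\<close>, and the integers, which
  are the lifts of the only fixed point. An interval has uncountably many points.
\<close>

lemma doubling_escape:
  assumes "r > 0" "finite F"
  shows "\<exists>z. dist x z < r \<and> doubling z \<notin> insert z F"
proof -
  define t where "t = Rep_circle x"
  define bad where "bad = \<int> \<union> (\<Union>y\<in>F. {s. circle_of (2 * s) = y})"
  have "countable (\<int> :: real set)"
    by (simp add: Ints_def)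
  then have "countable bad"
    unfolding bad_def using assms(2) countable_circle_of_double
    by (intro countable_Un countable_UN) (auto intro: countable_finite)
  moreover have "uncountable {t<..<t + r}"
    using assms(1) by (simp add: uncountable_open_interval)
  ultimately obtain s where s: "t < s" "s < t + r" "s \<notin> bad"
    using countable_subset[of "{t<..<t + r}" bad] by (metis greaterThanLessThan_iff subsetI)
  have "circle_of (2 * s) \<noteq> circle_of s"
  proof
    assume "circle_of (2 * s) = circle_of s"
    then have "frac (2 * s) = frac s"
      by (metis Rep_circle_of)
    then have "s = of_int (\<lfloor>2 * s\<rfloor> - \<lfloor>s\<rfloor>)"
      by (simp add: frac_def)
    then have "s \<in> \<int>"
      by (metis Ints_of_int)
    then show False
      using s(3) by (simp add: bad_def)
  qed
  moreover have "circle_of (2 * s) \<notin> F"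
    using s(3) by (auto simp: bad_def)
  moreover have "dist x (circle_of s) < r"
    using dist_circle_of_le[of t s] s(1,2) circle_of_Rep[of x] by (simp add: t_def)
  ultimately show ?thesis
    by (intro exI[of _ "circle_of s"]) (simp add: doubling_circle_of)
qed

theorem theorem5:
  "compact_space (mtopology_of (submetric hausdorff_metric (invariant_compacts doubling))) \<and>
   totally_disconnected_space
     (mtopology_of (submetric hausdorff_metric (invariant_compacts doubling))) \<and>
   first_category_in (mtopology_of hausdorff_metric) (invariant_compacts doubling)"
proof (intro conjI)
  show "compact_space (mtopology_of (submetric hausdorff_metric (invariant_compacts doubling)))"
    unfolding mtopology_of_submetric
    by (intro compact_space_subtopology closedin_compact_space compact_space_hausdorff
        compact_circle closedin_invariant_compacts continuous_on_doubling)
  show "totally_disconnected_space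
     (mtopology_of (submetric hausdorff_metric (invariant_compacts doubling)))"
    unfolding mtopology_of_submetric
    by (intro totally_disconnected_invariant_compacts doubling_neighbourhood)
  show "first_category_in (mtopology_of hausdorff_metric) (invariant_compacts doubling)"
    by (intro first_category_invariant_compacts continuous_on_doubling doubling_escape)
qed

end
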